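(* Let $\varepsilon\in(0,1)$. There is a streaming algorithm (CWEI$_2$) for insertion-only edge-arrival streams which, for every graph on $[n]$ with average degree $\bar d$ (no bound on the maximum degree is assumed), with high probability outputs a value $\widehat\lambda$ with $(1-\varepsilon)\lambda\le\widehat\lambda\le(1+\varepsilon)\lambda$, where $\lambda=\sum_{v}\frac{1}{d(v)+1}$ is the Caro–Wei bound, using $\mathcal O(\bar d^2\varepsilon^{-2}\log^2 n)$ bits of space.
   Context: Graphs are simple, undirected, on vertex set $[n]$ with $n$ known; $d(v)$ denotes the degree of $v$ and $\bar d$ the average degree (given to the algorithm). An insertion-only edge-arrival stream presents the edges one at a time in arbitrary order, with no deletions. "With high probability" means with failure probability at most $n^{-c'}$ for some constant $c'>1$. *)

theory Defs
  imports "HOL-Probability.Probability"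
begin

text \<open>
  A simple undirected graph on the vertex set {1..n} is given by its set of edges,
  each edge being a two-element subset of {1..n}.
\<close>

definition simple_graph_on :: "nat \<Rightarrow> nat set set \<Rightarrow> bool" where
  "simple_graph_on n E \<longleftrightarrow> (\<forall>e\<in>E. e \<subseteq> {1..n} \<and> card e = 2)"

definition vertex_degree :: "nat set set \<Rightarrow> nat \<Rightarrow> nat" where
  "vertex_degree E v = card {e \<in> E. v \<in> e}"

definition average_degree :: "nat \<Rightarrow> nat set set \<Rightarrow> real" where
  "average_degree n E = (\<Sum>v=1..n. real (vertex_degree E v)) / real n"

definition caro_wei :: "nat \<Rightarrow> nat set set \<Rightarrow> real" where
  "caro_wei n E = (\<Sum>v=1..n. 1 / (real (vertex_degree E v) + 1))"

text \<open>
  An insertion-only edge-arrival stream of a graph: every edge arrives exactly once,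
  in an arbitrary order.
\<close>

definition insertion_stream :: "nat set set \<Rightarrow> nat set list \<Rightarrow> bool" where
  "insertion_stream E \<sigma> \<longleftrightarrow> distinct \<sigma> \<and> set \<sigma> = E"

text \<open>
  A randomized one-pass streaming algorithm over a stream of items of type 'e. All that it
  retains between two items is its memory, a bit string. Fresh randomness may be drawn in
  every phase, but whatever is to be reused later (earlier coin tosses, the number of items
  read so far) has to be kept in memory.
\<close>

record 'e stream_alg =
  initial :: "bool list pmf"
  update :: "'e \<Rightarrow> bool list \<Rightarrow> bool list pmf"
  answer :: "bool list \<Rightarrow> real pmf"

text \<open>
  Space is worst case, over all streams and all outcomes of the coin tosses. The memory has
  a fixed size of s bits, so that its length carries no extra information.
\<close>

definition uses_bits :: "'e stream_alg \<Rightarrow> nat \<Rightarrow> bool" where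
  "uses_bits A s \<longleftrightarrow>
     (\<forall>w \<in> set_pmf (initial A). length w = s) \<and>
     (\<forall>x w. length w = s \<longrightarrow> (\<forall>w' \<in> set_pmf (update A x w). length w' = s))"

definition final_memory :: "'e stream_alg \<Rightarrow> 'e list \<Rightarrow> bool list pmf" where
  "final_memory A \<sigma> = fold (\<lambda>x M. bind_pmf M (update A x)) \<sigma> (initial A)"

definition run :: "'e stream_alg \<Rightarrow> 'e list \<Rightarrow> real pmf" where
  "run A \<sigma> = bind_pmf (final_memory A \<sigma>) (answer A)"

end

theory Submission
  imports Defs
begin

text \<open>
  If \<open>d \<le> \<epsilon>\<close>, the answer \<open>n\<close> is accurate enough and needs no memory. Otherwise about
  \<open>6 d\<^sup>2 ln n / \<epsilon>\<^sup>2\<close> independent samplers of \<open>O(log n)\<close> bits each are averaged, and Hoeffding's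
  inequality bounds the error of the average by \<open>\<epsilon> / (2 d)\<close>. For \<open>d \<ge> 1\<close> a sampler counts the degree
  of a random vertex and returns \<open>1 / (d(v) + 1)\<close>; the error is small enough since
  \<open>\<lambda> \<ge> n / (d + 1)\<close>. For small \<open>d < 1\<close> few vertices have an edge, and uniform vertex sampling would
  need too many samples. Instead one estimates \<open>n - \<lambda>\<close>, the sum of \<open>1 - 1 / (d(v) + 1)\<close>, as Alon, Matias and
  Szegedy estimate frequency moments: a sampler picks one of the \<open>n d\<close> edge endpoints in the stream
  uniformly at random, counts the later occurrences \<open>r\<close> of the same vertex, and returns
  \<open>1 / ((r + 1) (r + 2))\<close>. Here \<open>\<lambda> \<ge> n / 2\<close>, and scaling by \<open>n d\<close> instead of \<open>n\<close> saves the factor \<open>d\<close>.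
\<close>

section \<open>Concentration and streaming algorithms with finitely many states\<close>

text \<open>Under the product law the values \<open>f (\<omega> i)\<close> are independent, lie in
  \<open>[0, 1]\<close> and share the mean of \<open>f\<close> over \<open>I\<close>, so the
  two-sided Hoeffding bound applies.\<close>

lemma hoeffding_uniform_sample:
  fixes f :: "'s \<Rightarrow> real"
  assumes I: "finite I" "I \<noteq> {}" and f: "\<And>s. s \<in> I \<Longrightarrow> f s \<in> {0..1}"
    and t: "t \<ge> 0" and k: "k > 0"
  shows "measure_pmf.prob (Pi_pmf {..<k} dflt (\<lambda>_. pmf_of_set I))
      {\<omega>. t \<le> \<bar>(\<Sum>i<k. f (\<omega> i)) / real k - (\<Sum>s\<in>I. f s) / real (card I)\<bar>}
    \<le> 2 * exp (- 2 * real k * t\<^sup>2)"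
proof -
  define M where "M = Pi_pmf {..<k} dflt (\<lambda>_. pmf_of_set I)"
  have comp: "map_pmf (\<lambda>\<omega>. \<omega> i) M = pmf_of_set I" if "i < k" for i
    using that by (simp add: M_def Pi_pmf_component)
  have distr: "distr (measure_pmf M) borel (\<lambda>\<omega>. f (\<omega> i)) = distr (measure_pmf (pmf_of_set I)) borel f"
    if "i < k" for i
  proof -
    have "distr (measure_pmf M) borel (\<lambda>\<omega>. f (\<omega> i))
      = distr (measure_pmf (map_pmf (\<lambda>\<omega>. \<omega> i) M)) borel f"
      unfolding map_pmf_rep_eq by (subst distr_distr) (auto simp: o_def)
    then show ?thesis using comp[OF that] by simp
  qed
  have mean: "measure_pmf.expectation M (\<lambda>\<omega>. f (\<omega> 0)) = (\<Sum>s\<in>I. f s) / real (card I)"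
  proof -
    have "measure_pmf.expectation M (\<lambda>\<omega>. f (\<omega> 0)) = measure_pmf.expectation (map_pmf (\<lambda>\<omega>. \<omega> 0) M) f"
      by simp
    also have "\<dots> = (\<Sum>s\<in>I. f s) / real (card I)"
      using comp[OF k] I by (simp add: integral_pmf_of_set)
    finally show ?thesis .
  qed
  interpret H: Hoeffding_ineq_iid "measure_pmf M" "{..<k}" "\<lambda>i \<omega>. f (\<omega> i)" "\<lambda>\<omega>. f (\<omega> 0)" 0 1
    "(\<Sum>s\<in>I. f s) / real (card I)"
  proof unfold_locales
    show "prob_space.indep_vars (measure_pmf M) (\<lambda>_. borel) (\<lambda>i \<omega>. f (\<omega> i)) {..<k}"
      unfolding M_def
      by (intro prob_space.indep_vars_compose2[OF _ indep_vars_Pi_pmf])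
        (auto simp: measure_pmf.prob_space_axioms)
    have "f (\<omega> 0) \<in> {0..1}" if "\<omega> \<in> set_pmf M" for \<omega>
    proof -
      have "\<omega> 0 \<in> set_pmf (map_pmf (\<lambda>\<omega>. \<omega> 0) M)" using that by simp
      then show ?thesis using comp[OF k] I f by simp
    qed
    then show "AE \<omega> in measure_pmf M. f (\<omega> 0) \<in> {0..1}"
      by (auto simp: AE_measure_pmf_iff)
    show "(\<Sum>s\<in>I. f s) / real (card I) \<equiv> measure_pmf.expectation M (\<lambda>\<omega>. f (\<omega> 0))"
      by (rule eq_reflection) (simp add: mean)
  qed (use distr k in auto)
  show ?thesis
    using H.Hoeffding_ineq_abs_ge'[OF t] k by (simp add: M_def lessThan_empty_iff)
qed

text \<open>All randomness sits in the law \<open>D\<close> of the initial state; later phases are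
  deterministic. States inject into the bit strings of length \<open>s\<close>, and decoding,
  stepping and encoding again simulates the automaton.\<close>

lemma finite_state_stream_alg:
  assumes S: "finite S" "card S \<le> 2 ^ s" and init: "set_pmf D \<subseteq> S"
    and step: "\<And>e x. x \<in> S \<Longrightarrow> step e x \<in> S"
  obtains A where "uses_bits A s" "\<And>\<sigma>. run A \<sigma> = map_pmf (\<lambda>x. out (fold step \<sigma> x)) D"
proof -
  let ?B = "{w :: bool list. length w = s}"
  have B: "finite ?B" "card ?B = 2 ^ s"
    using finite_lists_length_eq[of "UNIV :: bool set" s] card_lists_length_eq[of "UNIV :: bool set" s]
    by simp_all
  obtain enc where enc: "inj_on enc S" "enc ` S \<subseteq> ?B"
    using card_le_inj[of S ?B] S B by auto
  \<comment> \<open>Strings that encode no state decode to some member of \<open>S\<close>, because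
    the space bound concerns every string of length \<open>s\<close>, not only the reachable
    ones.\<close>
  define dec where "dec w = (if w \<in> enc ` S then inv_into S enc w else (SOME x. x \<in> S))" for w
  obtain x0 where "x0 \<in> S" using init set_pmf_not_empty[of D] by blast
  then have dec_S: "dec w \<in> S" for w
    unfolding dec_def by (auto intro: inv_into_into someI)
  have dec_enc: "dec (enc x) = x" if "x \<in> S" for x
    using that enc by (simp add: dec_def)
  define A where "A = \<lparr>initial = map_pmf enc D,
    update = (\<lambda>e w. return_pmf (enc (step e (dec w)))),
    answer = (\<lambda>w. return_pmf (out (dec w)))\<rparr>"
  have "length (enc x) = s" if "x \<in> S" for x
    using that enc(2) by auto
  then have "uses_bits A s"
    using init step dec_S by (auto simp: uses_bits_def A_def)
  moreover
  \<comment> \<open>The law \<open>Q\<close> is kept general because reading an item replaces it by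
    its image under \<open>step e\<close>.\<close>
  have "fold (\<lambda>e M. bind_pmf M (update A e)) \<sigma> (map_pmf enc Q) = map_pmf enc (map_pmf (fold step \<sigma>) Q)"
    if "set_pmf Q \<subseteq> S" for \<sigma> Q
    using that
  proof (induction \<sigma> arbitrary: Q)
    case (Cons e \<sigma>)
    have "bind_pmf (map_pmf enc Q) (update A e) = bind_pmf Q (\<lambda>x. return_pmf (enc (step e (dec (enc x)))))"
      by (simp add: A_def bind_map_pmf)
    also have "\<dots> = bind_pmf Q (\<lambda>x. return_pmf (enc (step e x)))"
      by (intro bind_pmf_cong refl) (use Cons.prems dec_enc in auto)
    also have "\<dots> = map_pmf enc (map_pmf (step e) Q)"
      by (simp add: map_pmf_def bind_assoc_pmf bind_return_pmf)
    finally have *: "bind_pmf (map_pmf enc Q) (update A e) = map_pmf enc (map_pmf (step e) Q)" .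
    have "set_pmf (map_pmf (step e) Q) \<subseteq> S" using Cons.prems step by auto
    from Cons.IH[OF this] show ?case
      by (simp add: * pmf.map_comp o_def)
  qed (simp add: pmf.map_comp o_def)
  then have final: "final_memory A \<sigma> = map_pmf enc (map_pmf (fold step \<sigma>) D)" for \<sigma>
    using init by (simp add: final_memory_def A_def)
  have fold_S: "fold step \<sigma> x \<in> S" if "x \<in> S" for \<sigma> x
    using that by (induction \<sigma> arbitrary: x) (auto intro: step)
  have "run A \<sigma> = map_pmf (\<lambda>x. out (fold step \<sigma> x)) D" for \<sigma>
  proof -
    have "run A \<sigma> = bind_pmf D (\<lambda>x. return_pmf (out (dec (enc (fold step \<sigma> x)))))"
      by (simp add: run_def final bind_map_pmf) (simp add: A_def)
    also have "\<dots> = bind_pmf D (\<lambda>x. return_pmf (out (fold step \<sigma> x)))"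
      by (intro bind_pmf_cong refl) (use init fold_S dec_enc in auto)
    finally show ?thesis by (simp add: map_pmf_def)
  qed
  ultimately show ?thesis using that by blast
qed

text \<open>The memory is a list of \<open>k\<close> states from \<open>T\<close>, one of at most
  \<open>(2 ^ l) ^ k\<close> values. The copies start at independent uniform members of
  \<open>I\<close> and read the same stream. \<open>P\<close> is quantified after \<open>A\<close>,
  so that accuracy may refer to the unknown graph.\<close>

lemma parallel_sampling_alg:
  fixes step :: "'e \<Rightarrow> 's \<Rightarrow> 's" and f :: "'s \<Rightarrow> real"
  assumes T: "finite T" "card T \<le> 2 ^ l" and I: "I \<subseteq> T" "I \<noteq> {}"
    and step: "\<And>e x. x \<in> T \<Longrightarrow> step e x \<in> T" and t: "t \<ge> 0" and k: "k > 0"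
  obtains A where "uses_bits A (l * k)"
    "\<And>\<sigma> P. (\<And>s. s \<in> I \<Longrightarrow> f (fold step \<sigma> s) \<in> {0..1}) \<Longrightarrow>
      (\<And>a. \<bar>a - (\<Sum>s\<in>I. f (fold step \<sigma> s)) / real (card I)\<bar> < t \<Longrightarrow> P (out a)) \<Longrightarrow>
      measure_pmf.prob (run A \<sigma>) {x. \<not> P x} \<le> 2 * exp (- 2 * real k * t\<^sup>2)"
proof -
  have finI: "finite I" using I T finite_subset by blast
  define M where "M = Pi_pmf {..<k} undefined (\<lambda>_. pmf_of_set I)"
  define S where "S = {xs. set xs \<subseteq> T \<and> length xs = k}"
  have "card T ^ k \<le> (2 ^ l) ^ k" by (rule power_mono) (use T in auto)
  then have S: "finite S" "card S \<le> 2 ^ (l * k)"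
    using finite_lists_length_eq[of T k] card_lists_length_eq[of T k] T
    by (simp_all add: S_def power_mult)
  have M_I: "\<omega> i \<in> I" if "\<omega> \<in> set_pmf M" "i < k" for \<omega> i
    using that set_Pi_pmf_subset'[of "{..<k}" undefined "\<lambda>_. pmf_of_set I"] finI I
    by (force simp: M_def PiE_dflt_def)
  define D where "D = map_pmf (\<lambda>\<omega>. map \<omega> [0..<k]) M"
  have D: "set_pmf D \<subseteq> S" using M_I I by (force simp: D_def S_def)
  have stepS: "map (step e) xs \<in> S" if "xs \<in> S" for e xs
    using that step by (auto simp: S_def)
  obtain A where A: "uses_bits A (l * k)"
    "\<And>\<sigma>. run A \<sigma> = map_pmf (\<lambda>x. out (sum_list (map f (fold (\<lambda>e. map (step e)) \<sigma> x)) / real k)) D"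
    using finite_state_stream_alg[where step = "\<lambda>e. map (step e)" and
      out = "\<lambda>xs. out (sum_list (map f xs) / real k)", OF S D stepS] by metis
  have fold_map: "fold (\<lambda>e. map (step e)) \<sigma> xs = map (fold step \<sigma>) xs" for \<sigma> xs
    by (induction \<sigma> arbitrary: xs) auto
  have run: "run A \<sigma> = map_pmf (\<lambda>\<omega>. out ((\<Sum>i<k. f (fold step \<sigma> (\<omega> i))) / real k)) M" for \<sigma>
    by (simp add: A(2) D_def pmf.map_comp fold_map o_def interv_sum_list_conv_sum_set_nat
      atLeast0LessThan)
  show ?thesis
  proof (rule that[OF A(1)])
    fix \<sigma> P
    assume f: "\<And>s. s \<in> I \<Longrightarrow> f (fold step \<sigma> s) \<in> {0..1}"
      and P: "\<And>a. \<bar>a - (\<Sum>s\<in>I. f (fold step \<sigma> s)) / real (card I)\<bar> < t \<Longrightarrow> P (out a)"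
    \<comment> \<open>A sample mean within \<open>t\<close> of the true mean gives \<open>P\<close>,
      so failure lies in the deviation event.\<close>
    have "measure_pmf.prob (run A \<sigma>) {x. \<not> P x}
        \<le> measure_pmf.prob M {\<omega>. t \<le> \<bar>(\<Sum>i<k. f (fold step \<sigma> (\<omega> i))) / real k
            - (\<Sum>s\<in>I. f (fold step \<sigma> s)) / real (card I)\<bar>}"
      unfolding run by (simp, rule measure_pmf.finite_measure_mono) (auto intro: leI P)
    also have "\<dots> \<le> 2 * exp (- 2 * real k * t\<^sup>2)"
      unfolding M_def by (rule hoeffding_uniform_sample) (use finI I f t k in auto)
    finally show "measure_pmf.prob (run A \<sigma>) {x. \<not> P x} \<le> 2 * exp (- 2 * real k * t\<^sup>2)" .
  qed
qed

section \<open>Edge streams as sequences of endpoints\<close>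

definition endpoints :: "nat set list \<Rightarrow> nat list" where
  "endpoints \<sigma> = concat (map (\<lambda>e. [Min e, Max e]) \<sigma>)"

text \<open>The two endpoints of an edge differ, so it adds exactly one to the count of each of its
  vertices, and distinctness of the stream makes every edge count once.\<close>

lemma
  assumes E: "simple_graph_on n E" and \<sigma>: "insertion_stream E \<sigma>"
  shows count_endpoints: "count_list (endpoints \<sigma>) v = vertex_degree E v"
    and set_endpoints: "set (endpoints \<sigma>) \<subseteq> {1..n}"
proof -
  have min_max: "(Min e = v \<or> Max e = v) = (v \<in> e)" "Min e \<noteq> Max e" "Min e \<in> e" "Max e \<in> e"
    if e: "card e = 2" for e :: "nat set" and v
  proof -
    obtain a b where "e = {a, b}" "a \<noteq> b" using e by (auto simp: card_2_iff)
    then show "(Min e = v \<or> Max e = v) = (v \<in> e)" "Min e \<noteq> Max e" "Min e \<in> e" "Max e \<in> e"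
      by (auto simp: min_def max_def)
  qed
  have count: "count_list (endpoints \<tau>) v = length (filter (\<lambda>e. v \<in> e) \<tau>)" if "\<forall>e\<in>set \<tau>. card e = 2" for \<tau>
    using that
  proof (induction \<tau>)
    case (Cons e \<tau>)
    then show ?case
      using min_max(1)[of e v] min_max(2)[of e] by (auto simp: endpoints_def)
  qed (simp add: endpoints_def)
  have edges: "card e = 2" "e \<subseteq> {1..n}" if "e \<in> set \<sigma>" for e
    using that E \<sigma> by (auto simp: simple_graph_on_def insertion_stream_def)
  have "distinct \<sigma>" "set \<sigma> = E" using \<sigma> by (auto simp: insertion_stream_def)
  then show "count_list (endpoints \<sigma>) v = vertex_degree E v"
    using count[of \<sigma>] edges by (simp add: vertex_degree_def distinct_length_filter Int_def conj_commute)
  have "Min e \<in> {1..n}" "Max e \<in> {1..n}" if "e \<in> set \<sigma>" for e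
    using min_max(3,4) edges[OF that] by blast+
  then show "set (endpoints \<sigma>) \<subseteq> {1..n}"
    by (auto simp: endpoints_def)
qed

text \<open>Every edge at \<open>v\<close> has the form \<open>{v, u}\<close> with \<open>u\<close>
  in \<open>{1..n}\<close>. Hence the cap at \<open>n\<close> in the counter of a sampler never
  distorts a count on a graph.\<close>

lemma vertex_degree_le:
  assumes "simple_graph_on n E"
  shows "vertex_degree E v \<le> n"
proof -
  have "{e \<in> E. v \<in> e} \<subseteq> (\<lambda>u. {v, u}) ` {1..n}"
  proof
    fix e assume e: "e \<in> {e \<in> E. v \<in> e}"
    then obtain a b where "e = {a, b}" "a \<in> {1..n}" "b \<in> {1..n}"
      using assms by (fastforce simp: simple_graph_on_def card_2_iff)
    with e show "e \<in> (\<lambda>u. {v, u}) ` {1..n}" by auto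
  qed
  then have "vertex_degree E v \<le> card {1..n}"
    unfolding vertex_degree_def by (rule surj_card_le[rotated]) simp
  then show ?thesis by simp
qed

section \<open>Samplers and the telescoping sum of their values\<close>

text \<open>
  A sampler state \<open>(c, v, r)\<close> waits for \<open>c\<close> more endpoints, adopts the last of them as its
  vertex \<open>v\<close>, and then counts in \<open>r\<close> the further occurrences of \<open>v\<close>. The truncation at \<open>n\<close>
  only serves to keep the state space finite on streams that are not graphs on \<open>{1..n}\<close>.
\<close>

fun sampler_step :: "nat \<Rightarrow> nat \<Rightarrow> nat \<times> nat \<times> nat \<Rightarrow> nat \<times> nat \<times> nat" where
  "sampler_step n x (0, v, r) = (0, v, if x = v then min n (Suc r) else r)"
| "sampler_step n x (Suc 0, v, r) = (0, min n x, 0)"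
| "sampler_step n x (Suc (Suc c), v, r) = (Suc c, v, r)"

definition edge_step :: "nat \<Rightarrow> nat set \<Rightarrow> nat \<times> nat \<times> nat \<Rightarrow> nat \<times> nat \<times> nat" where
  "edge_step n e = sampler_step n (Max e) \<circ> sampler_step n (Min e)"

lemma sampler_step_closed:
  "s \<in> {0..n} \<times> {0..n} \<times> {0..n} \<Longrightarrow> sampler_step n x s \<in> {0..n} \<times> {0..n} \<times> {0..n}"
  by (cases "(n, x, s)" rule: sampler_step.cases) auto

lemma edge_step_closed:
  "s \<in> {0..n} \<times> {0..n} \<times> {0..n} \<Longrightarrow> edge_step n e s \<in> {0..n} \<times> {0..n} \<times> {0..n}"
  unfolding edge_step_def comp_def by (intro sampler_step_closed)

lemma fold_edge_step: "fold (edge_step n) \<sigma> s = fold (sampler_step n) (endpoints \<sigma>) s"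
  by (induction \<sigma> arbitrary: s) (auto simp: endpoints_def edge_step_def)

lemma fold_sampler_step_counting:
  "r \<le> n \<Longrightarrow> fold (sampler_step n) xs (0, v, r) = (0, v, min n (r + count_list xs v))"
  by (induction xs arbitrary: r) auto

text \<open>The first \<open>i\<close> entries lower the counter to \<open>Suc 0\<close>; the next
  one, \<open>xs ! i\<close>, is adopted, and counting starts after it. Entries are at most
  \<open>n\<close>, so truncation leaves the adopted vertex unchanged.\<close>

lemma fold_sampler_step_waiting:
  assumes "set xs \<subseteq> {..n}" "i < length xs"
  shows "fold (sampler_step n) xs (Suc i, v, r)
    = (0, xs ! i, min n (count_list (drop (Suc i) xs) (xs ! i)))"
  using assms
proof (induction xs arbitrary: i)
  case (Cons x xs)
  then show ?case
    by (cases i) (auto simp: fold_sampler_step_counting min_absorb2)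
qed simp

text \<open>The increments of \<open>g k = 1 - 1 / (k + 1)\<close> are \<open>1 / ((k + 1) * (k + 2))\<close>, so the sum telescopes.\<close>

lemma sum_suffix_counts:
  assumes "finite V" "set xs \<subseteq> V"
  shows "(\<Sum>i<length xs. let r = real (count_list (drop (Suc i) xs) (xs ! i)) in 1 / ((r + 1) * (r + 2)))
    = (\<Sum>v\<in>V. 1 - 1 / (real (count_list xs v) + 1))"
  using assms(2)
proof (induction xs)
  case (Cons x xs)
  let ?g = "\<lambda>k::nat. 1 - 1 / (real k + 1)"
  have inc: "?g (Suc k) = ?g k + 1 / ((real k + 1) * (real k + 2))" for k
    by (simp add: divide_simps) (simp add: algebra_simps)
  have x: "x \<in> V" using Cons.prems by simp
  \<comment> \<open>Prepending \<open>x\<close> adds a position with suffix count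
    \<open>count_list xs x\<close> and raises the count of \<open>x\<close> alone, so only the
    summand of \<open>x\<close> changes, by the increment \<open>inc\<close>.\<close>
  have "(\<Sum>v\<in>V. ?g (count_list (x # xs) v))
      = ?g (Suc (count_list xs x)) + (\<Sum>v\<in>V - {x}. ?g (count_list (x # xs) v))"
    by (subst sum.remove[OF assms(1) x]) simp
  also have "(\<Sum>v\<in>V - {x}. ?g (count_list (x # xs) v)) = (\<Sum>v\<in>V - {x}. ?g (count_list xs v))"
    by (intro sum.cong) auto
  also have "?g (Suc (count_list xs x)) + \<dots>
      = 1 / ((real (count_list xs x) + 1) * (real (count_list xs x) + 2)) + (\<Sum>v\<in>V. ?g (count_list xs v))"
    unfolding inc sum.remove[OF assms(1) x, of "\<lambda>v. ?g (count_list xs v)"] by simp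
  finally show ?case
    using Cons by (simp only: length_Cons sum.lessThan_Suc_shift) (simp add: Let_def)
qed simp

section \<open>Bounds on the Caro-Wei sum in terms of the average degree\<close>

lemma sum_vertex_degree:
  assumes "n \<ge> 1"
  shows "(\<Sum>v=1..n. real (vertex_degree E v)) = real n * average_degree n E"
  using assms by (simp add: average_degree_def)

lemma caro_wei_le: "caro_wei n E \<le> real n"
proof -
  have "caro_wei n E \<le> (\<Sum>v=1..n. 1)"
    unfolding caro_wei_def by (intro sum_mono) simp
  then show ?thesis by simp
qed

text \<open>The line \<open>1 - k / 2\<close> meets \<open>1 / (k + 1)\<close> at
  \<open>k = 0\<close> and \<open>k = 1\<close> and lies below it at all larger integers.
  Integrality of degrees matters: the comparison fails for \<open>0 < k < 1\<close>.\<close>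

lemma caro_wei_ge_linear:
  assumes "n \<ge> 1"
  shows "real n - real n * average_degree n E / 2 \<le> caro_wei n E"
proof -
  have *: "1 - real k / 2 \<le> 1 / (real k + 1)" for k :: nat
  proof -
    have "0 \<le> real k * (real k - 1)" by (cases k) auto
    then show ?thesis by (simp add: field_simps)
  qed
  have "real n - real n * average_degree n E / 2 = (\<Sum>v=1..n. 1 - real (vertex_degree E v) / 2)"
    by (simp add: sum_subtractf flip: sum_divide_distrib sum_vertex_degree[OF assms])
  also have "\<dots> \<le> caro_wei n E"
    unfolding caro_wei_def by (intro sum_mono *)
  finally show ?thesis .
qed

lemma average_degree_nonneg: "0 \<le> average_degree n E"
  by (simp add: average_degree_def sum_nonneg)

text \<open>This is Jensen's inequality for the convex function \<open>1 / x\<close> at the values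
  \<open>d(v) + 1\<close>, proved with the tangent at their mean \<open>?a\<close>.\<close>

lemma caro_wei_ge_harmonic:
  assumes "n \<ge> 1"
  shows "real n / (average_degree n E + 1) \<le> caro_wei n E"
proof -
  let ?a = "average_degree n E + 1"
  have a: "?a > 0" using average_degree_nonneg[of n E] by simp
  have tangent: "2 / ?a - (real k + 1) / ?a\<^sup>2 \<le> 1 / (real k + 1)" for k :: nat
  proof -
    \<comment> \<open>The gap between \<open>1 / x\<close> and its tangent at \<open>?a\<close> is
      \<open>(?a - x)\<^sup>2 / (?a\<^sup>2 * x)\<close>.\<close>
    have "0 \<le> (?a - (real k + 1))\<^sup>2 / (?a\<^sup>2 * (real k + 1))" by simp
    also have "\<dots> = 1 / (real k + 1) - 2 / ?a + (real k + 1) / ?a\<^sup>2"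
      using a by (simp add: divide_simps power2_eq_square) (simp add: algebra_simps)
    finally show ?thesis by simp
  qed
  have "real n / ?a = real n * (2 / ?a) - (real n * average_degree n E + real n) / ?a\<^sup>2"
    using a by (simp add: divide_simps power2_eq_square) (simp add: algebra_simps)
  also have "\<dots> = (\<Sum>v=1..n. 2 / ?a - (real (vertex_degree E v) + 1) / ?a\<^sup>2)"
    by (simp add: sum_subtractf sum.distrib flip: sum_divide_distrib sum_vertex_degree[OF assms])
  also have "\<dots> \<le> caro_wei n E"
    unfolding caro_wei_def by (intro sum_mono tangent)
  finally show ?thesis .
qed

text \<open>Positive average degree forces an edge, which has two vertices. This later yields
  \<open>log 2 n \<ge> 1\<close>, which absorbs roundings.\<close>

lemma two_le_vertices:
  assumes "simple_graph_on n E" "average_degree n E > 0"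
  shows "n \<ge> 2"
proof (rule ccontr)
  assume "\<not> n \<ge> 2"
  then have n: "n \<le> 1" by simp
  have "E = {}"
  proof (rule ccontr)
    assume "E \<noteq> {}"
    then obtain e where "e \<subseteq> {1..n}" "card e = 2" using assms by (auto simp: simple_graph_on_def)
    then have "2 \<le> card {1..n}" by (metis card_mono finite_atLeastAtMost)
    with n show False by simp
  qed
  then show False using assms by (simp add: average_degree_def vertex_degree_def)
qed

section \<open>Vertex sampling for \<open>d \<ge> 1\<close> and endpoint sampling for
  \<open>d < 1\<close>\<close>

text \<open>The samples have mean \<open>caro_wei n E / n\<close>. Scaled by \<open>n\<close>, an
  error of \<open>\<epsilon> / (2 * d)\<close> becomes at most
  \<open>\<epsilon> * n / (d + 1)\<close>, because \<open>d + 1 \<le> 2 * d\<close>; the harmonic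
  lower bound turns this into a relative error.\<close>

lemma dense_sampling_alg:
  assumes n: "n \<ge> 1" and d: "d \<ge> 1" and \<epsilon>: "\<epsilon> > 0" and l: "(n + 1) ^ 3 \<le> 2 ^ l" and k: "k > 0"
  obtains A where "uses_bits A (l * k)"
    "\<And>E \<sigma>. simple_graph_on n E \<Longrightarrow> average_degree n E = d \<Longrightarrow> insertion_stream E \<sigma> \<Longrightarrow>
      measure_pmf.prob (run A \<sigma>)
        {x. \<not> ((1 - \<epsilon>) * caro_wei n E \<le> x \<and> x \<le> (1 + \<epsilon>) * caro_wei n E)}
      \<le> 2 * exp (- 2 * real k * (\<epsilon> / (2 * d))\<^sup>2)"
proof -
  define f where "f = (\<lambda>(c :: nat, v :: nat, r :: nat). 1 / (real r + 1))"
  \<comment> \<open>With waiting time 0 the sampler counts from the first edge on and ends with the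
    full degree of \<open>v\<close>.\<close>
  define I :: "(nat \<times> nat \<times> nat) set" where "I = (\<lambda>v. (0, v, 0)) ` {1..n}"
  have card_T: "card ({0..n} \<times> {0..n} \<times> {0..n}) \<le> 2 ^ l"
    using l by (simp add: card_cartesian_product power3_eq_cube mult.assoc del: mult_Suc mult_Suc_right)
  have I: "I \<subseteq> {0..n} \<times> {0..n} \<times> {0..n}" "I \<noteq> {}"
    using n by (auto simp: I_def)
  have t: "\<epsilon> / (2 * d) \<ge> 0" using d \<epsilon> by simp
  obtain A where A: "uses_bits A (l * k)"
    "\<And>\<sigma> P. (\<And>s. s \<in> I \<Longrightarrow> f (fold (edge_step n) \<sigma> s) \<in> {0..1}) \<Longrightarrow>
      (\<And>a. \<bar>a - (\<Sum>s\<in>I. f (fold (edge_step n) \<sigma> s)) / real (card I)\<bar> < \<epsilon> / (2 * d)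
        \<Longrightarrow> P (real n * a)) \<Longrightarrow>
      measure_pmf.prob (run A \<sigma>) {x. \<not> P x} \<le> 2 * exp (- 2 * real k * (\<epsilon> / (2 * d))\<^sup>2)"
  proof (rule parallel_sampling_alg[where f = f and step = "edge_step n" and out = "\<lambda>a. real n * a",
          OF _ card_T I edge_step_closed t k], goal_cases)
    case (3 A)
    show ?case by (rule 3(1)[OF 3(2,3)])
  qed (intro finite_SigmaI finite_atLeastAtMost)
  show ?thesis
  proof (rule that[OF A(1)])
    fix E \<sigma> assume E: "simple_graph_on n E" "average_degree n E = d" and \<sigma>: "insertion_stream E \<sigma>"
    have final: "fold (edge_step n) \<sigma> (0, v, 0) = (0, v, vertex_degree E v)" for v
      using vertex_degree_le[OF E(1)]
      by (simp add: fold_edge_step fold_sampler_step_counting count_endpoints[OF E(1) \<sigma>] min_absorb2)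
    have inj: "inj_on (\<lambda>v::nat. (0::nat, v, 0::nat)) {1..n}" by (auto simp: inj_on_def)
    have mean: "(\<Sum>s\<in>I. f (fold (edge_step n) \<sigma> s)) / real (card I) = caro_wei n E / real n"
      unfolding I_def by (simp add: sum.reindex[OF inj] card_image[OF inj] final f_def caro_wei_def del: One_nat_def)
    show "measure_pmf.prob (run A \<sigma>)
        {x. \<not> ((1 - \<epsilon>) * caro_wei n E \<le> x \<and> x \<le> (1 + \<epsilon>) * caro_wei n E)}
      \<le> 2 * exp (- 2 * real k * (\<epsilon> / (2 * d))\<^sup>2)"
    proof (rule A(2))
      show "f (fold (edge_step n) \<sigma> s) \<in> {0..1}" for s
        by (cases "fold (edge_step n) \<sigma> s") (simp add: f_def)
      fix a assume "\<bar>a - (\<Sum>s\<in>I. f (fold (edge_step n) \<sigma> s)) / real (card I)\<bar> < \<epsilon> / (2 * d)"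
      then have "real n * \<bar>a - caro_wei n E / real n\<bar> \<le> real n * (\<epsilon> / (2 * d))"
        unfolding mean by (intro mult_left_mono) auto
      also have "\<dots> \<le> \<epsilon> * (real n / (d + 1))"
        using d \<epsilon> mult_right_mono[OF d, of "real n"] by (simp add: field_simps)
      also have "\<dots> \<le> \<epsilon> * caro_wei n E"
        using caro_wei_ge_harmonic[OF n, of E] E \<epsilon> by (intro mult_left_mono) auto
      also have "real n * \<bar>a - caro_wei n E / real n\<bar> = \<bar>real n * (a - caro_wei n E / real n)\<bar>"
        by (simp add: abs_mult)
      also have "real n * (a - caro_wei n E / real n) = real n * a - caro_wei n E"
        using n by (simp add: field_simps)
      finally show "(1 - \<epsilon>) * caro_wei n E \<le> real n * a \<and> real n * a \<le> (1 + \<epsilon>) * caro_wei n E"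
        by (simp add: algebra_simps abs_le_iff)
    qed
  qed
qed

text \<open>The samples have mean \<open>(n - caro_wei n E) / N\<close>. Scaled by
  \<open>N = n * d\<close>, an error of \<open>\<epsilon> / (2 * d)\<close> becomes
  \<open>\<epsilon> * n / 2\<close>, a relative error since \<open>d < 1\<close>. As
  \<open>N\<close> depends on \<open>n\<close> and \<open>d\<close> only, the number of endpoints is
  known before the stream starts.\<close>

lemma sparse_sampling_alg:
  assumes n: "n \<ge> 1" and d: "0 < d" "d < 1" and \<epsilon>: "\<epsilon> > 0" and l: "(n + 1) ^ 3 \<le> 2 ^ l" and k: "k > 0"
    and N: "real N = real n * d"
  obtains A where "uses_bits A (l * k)"
    "\<And>E \<sigma>. simple_graph_on n E \<Longrightarrow> average_degree n E = d \<Longrightarrow> insertion_stream E \<sigma> \<Longrightarrow>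
      measure_pmf.prob (run A \<sigma>)
        {x. \<not> ((1 - \<epsilon>) * caro_wei n E \<le> x \<and> x \<le> (1 + \<epsilon>) * caro_wei n E)}
      \<le> 2 * exp (- 2 * real k * (\<epsilon> / (2 * d))\<^sup>2)"
proof -
  define f where "f = (\<lambda>(c :: nat, v :: nat, r :: nat). 1 / ((real r + 1) * (real r + 2)))"
  \<comment> \<open>Waiting time \<open>Suc i\<close> selects the endpoint at index
    \<open>i\<close>. It is at most \<open>N\<close>, hence at most \<open>n\<close> as
    \<open>d < 1\<close>, and so fits into the state space.\<close>
  define I :: "(nat \<times> nat \<times> nat) set" where "I = (\<lambda>i. (Suc i, 0, 0)) ` {..<N}"
  have card_T: "card ({0..n} \<times> {0..n} \<times> {0..n}) \<le> 2 ^ l"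
    using l by (simp add: card_cartesian_product power3_eq_cube mult.assoc del: mult_Suc mult_Suc_right)
  have "real N > 0" using N n d by simp
  then have N0: "N > 0" by simp
  have "real N \<le> real n" using N n d by simp
  then have I: "I \<subseteq> {0..n} \<times> {0..n} \<times> {0..n}" "I \<noteq> {}"
    using N0 by (auto simp: I_def)
  have t: "\<epsilon> / (2 * d) \<ge> 0" using d \<epsilon> by simp
  obtain A where A: "uses_bits A (l * k)"
    "\<And>\<sigma> P. (\<And>s. s \<in> I \<Longrightarrow> f (fold (edge_step n) \<sigma> s) \<in> {0..1}) \<Longrightarrow>
      (\<And>a. \<bar>a - (\<Sum>s\<in>I. f (fold (edge_step n) \<sigma> s)) / real (card I)\<bar> < \<epsilon> / (2 * d)
        \<Longrightarrow> P (real n - real N * a)) \<Longrightarrow>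
      measure_pmf.prob (run A \<sigma>) {x. \<not> P x} \<le> 2 * exp (- 2 * real k * (\<epsilon> / (2 * d))\<^sup>2)"
  proof (rule parallel_sampling_alg[where f = f and step = "edge_step n" and out = "\<lambda>a. real n - real N * a",
          OF _ card_T I edge_step_closed t k], goal_cases)
    case (3 A)
    show ?case by (rule 3(1)[OF 3(2,3)])
  qed (intro finite_SigmaI finite_atLeastAtMost)
  show ?thesis
  proof (rule that[OF A(1)])
    fix E \<sigma> assume E: "simple_graph_on n E" "average_degree n E = d" and \<sigma>: "insertion_stream E \<sigma>"
    let ?xs = "endpoints \<sigma>"
    note count = count_endpoints[OF E(1) \<sigma>] and set = set_endpoints[OF E(1) \<sigma>]
    \<comment> \<open>Each endpoint counts towards the degree of one vertex, so the length is the
      degree sum.\<close>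
    have "real (length ?xs) = real (\<Sum>v=1..n. vertex_degree E v)"
      using sum_count_set[OF set] by (simp add: count)
    then have len: "length ?xs = N"
      using sum_vertex_degree[OF n, of E] E N by simp
    have suffix: "count_list (drop (Suc i) ?xs) v \<le> n" for i v
    proof -
      have "count_list (drop (Suc i) ?xs) v \<le> count_list ?xs v"
        by (metis append_take_drop_id count_list_append le_add2)
      then show ?thesis using vertex_degree_le[OF E(1), of v] count by simp
    qed
    have final: "fold (edge_step n) \<sigma> (Suc i, 0, 0) = (0, ?xs ! i, count_list (drop (Suc i) ?xs) (?xs ! i))"
      if "i < N" for i
    proof -
      have "set ?xs \<subseteq> {..n}" using set by auto
      then show ?thesis
        using fold_sampler_step_waiting[of ?xs n i 0 0] that len suffix
        by (simp add: fold_edge_step min_absorb2)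
    qed
    have inj: "inj_on (\<lambda>i. (Suc i, 0::nat, 0::nat)) {..<N}" by (auto simp: inj_on_def)
    have "(\<Sum>s\<in>I. f (fold (edge_step n) \<sigma> s)) = (\<Sum>v=1..n. 1 - 1 / (real (vertex_degree E v) + 1))"
      using sum_suffix_counts[OF _ set]
      by (simp add: I_def sum.reindex[OF inj] final f_def Let_def len count)
    then have mean: "(\<Sum>s\<in>I. f (fold (edge_step n) \<sigma> s)) / real (card I) = (real n - caro_wei n E) / real N"
      by (simp add: I_def card_image[OF inj] caro_wei_def sum_subtractf)
    show "measure_pmf.prob (run A \<sigma>)
        {x. \<not> ((1 - \<epsilon>) * caro_wei n E \<le> x \<and> x \<le> (1 + \<epsilon>) * caro_wei n E)}
      \<le> 2 * exp (- 2 * real k * (\<epsilon> / (2 * d))\<^sup>2)"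
    proof (rule A(2))
      have "1 \<le> (real r + 1) * (real r + 2)" for r :: nat
        by (simp add: algebra_simps)
      then show "f (fold (edge_step n) \<sigma> s) \<in> {0..1}" for s
        by (cases "fold (edge_step n) \<sigma> s") (simp add: f_def)
      fix a assume "\<bar>a - (\<Sum>s\<in>I. f (fold (edge_step n) \<sigma> s)) / real (card I)\<bar> < \<epsilon> / (2 * d)"
      then have "real N * \<bar>a - (real n - caro_wei n E) / real N\<bar> \<le> real N * (\<epsilon> / (2 * d))"
        unfolding mean by (intro mult_left_mono) auto
      also have "\<dots> = \<epsilon> * (real n / 2)"
        using d N by simp
      also have "\<dots> \<le> \<epsilon> * caro_wei n E"
      proof (rule mult_left_mono)
        have "real n * d \<le> real n" using d n by simp
        then show "real n / 2 \<le> caro_wei n E"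
          using caro_wei_ge_linear[OF n, of E] E by simp
      qed (use \<epsilon> in simp)
      also have "real N * \<bar>a - (real n - caro_wei n E) / real N\<bar>
          = \<bar>real N * (a - (real n - caro_wei n E) / real N)\<bar>"
        by (simp add: abs_mult)
      also have "real N * (a - (real n - caro_wei n E) / real N) = real N * a - real n + caro_wei n E"
        using N0 by (simp add: field_simps)
      finally show "(1 - \<epsilon>) * caro_wei n E \<le> real n - real N * a
          \<and> real n - real N * a \<le> (1 + \<epsilon>) * caro_wei n E"
        by (simp add: algebra_simps abs_le_iff)
    qed
  qed
qed

section \<open>Very small average degree and the choice of parameters\<close>

text \<open>The linear bound gives \<open>caro_wei n E \<ge> n * (1 - \<epsilon> / 2)\<close>, and
  \<open>(1 + \<epsilon>) * (1 - \<epsilon> / 2) \<ge> 1\<close> because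
  \<open>\<epsilon> \<le> 1\<close>.\<close>

lemma average_degree_small:
  assumes "n \<ge> 1" "average_degree n E \<le> \<epsilon>" "0 < \<epsilon>" "\<epsilon> < 1"
  shows "(1 - \<epsilon>) * caro_wei n E \<le> real n \<and> real n \<le> (1 + \<epsilon>) * caro_wei n E"
proof
  have "0 \<le> caro_wei n E" by (simp add: caro_wei_def sum_nonneg)
  then have "(1 - \<epsilon>) * caro_wei n E \<le> 1 * caro_wei n E"
    using assms by (intro mult_right_mono) auto
  then show "(1 - \<epsilon>) * caro_wei n E \<le> real n"
    using caro_wei_le[of n E] by simp
  have "\<epsilon> * \<epsilon> \<le> \<epsilon> * 1" using assms by (intro mult_left_mono) auto
  then have "1 \<le> (1 + \<epsilon>) * (1 - \<epsilon> / 2)" by (simp add: algebra_simps)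
  then have "real n * 1 \<le> real n * ((1 + \<epsilon>) * (1 - \<epsilon> / 2))"
    by (intro mult_left_mono) auto
  also have "\<dots> = (1 + \<epsilon>) * (real n - real n * \<epsilon> / 2)"
    by (simp add: algebra_simps)
  also have "\<dots> \<le> (1 + \<epsilon>) * caro_wei n E"
  proof (rule mult_left_mono)
    have "real n * average_degree n E \<le> real n * \<epsilon>"
      using assms by (intro mult_left_mono) auto
    then show "real n - real n * \<epsilon> / 2 \<le> caro_wei n E"
      using caro_wei_ge_linear[OF assms(1), of E] by simp
  qed (use assms in simp)
  finally show "real n \<le> (1 + \<epsilon>) * caro_wei n E" by simp
qed

lemma zero_space_alg:
  obtains A where "uses_bits A 0" "\<And>\<sigma>. run A \<sigma> = return_pmf x"
  using finite_state_stream_alg[of "{()}" 0 "return_pmf ()" "\<lambda>_ _. ()" "\<lambda>_. x"] by auto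

text \<open>One algorithm has to serve all graphs with the given \<open>n\<close> and
  \<open>d\<close>, so it cannot depend on \<open>E\<close>. If no graph has these parameters, the
  condition is vacuous.\<close>

definition estimates_caro_wei :: "real \<Rightarrow> nat \<Rightarrow> real \<Rightarrow> nat set stream_alg \<Rightarrow> bool" where
  "estimates_caro_wei \<epsilon> n d A \<longleftrightarrow> (\<forall>E. n \<ge> 1 \<and> simple_graph_on n E \<and> average_degree n E = d \<longrightarrow>
    (\<exists>s::nat. uses_bits A s \<and> real s \<le> 49 * (d\<^sup>2 * (1 / \<epsilon>\<^sup>2) * (log 2 (real n))\<^sup>2)) \<and>
    (\<forall>\<sigma>. insertion_stream E \<sigma> \<longrightarrow>
      measure_pmf.prob (run A \<sigma>)
        {x. \<not> ((1 - \<epsilon>) * caro_wei n E \<le> x \<and> x \<le> (1 + \<epsilon>) * caro_wei n E)} \<le> real n powr (- 2)))"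

lemma estimates_caro_wei_exists:
  assumes \<epsilon>: "0 < \<epsilon>" "\<epsilon> < 1"
  shows "\<exists>A. estimates_caro_wei \<epsilon> n d A"
proof (cases "\<exists>E. n \<ge> 1 \<and> simple_graph_on n E \<and> average_degree n E = d")
  case True
  then obtain E0 where n1: "n \<ge> 1" and E0: "simple_graph_on n E0" "average_degree n E0 = d" by blast
  show ?thesis
  proof (cases "d \<le> \<epsilon>")
    \<comment> \<open>This case covers \<open>d = 0\<close>, and with it \<open>n = 1\<close>, where
      the space bound is zero and no memory is allowed.\<close>
    case True
    obtain A :: "nat set stream_alg" where A: "uses_bits A 0" "\<And>\<sigma>. run A \<sigma> = return_pmf (real n)"
      using zero_space_alg by blast
    have "measure_pmf.prob (return_pmf (real n))
        {x. \<not> ((1 - \<epsilon>) * caro_wei n E \<le> x \<and> x \<le> (1 + \<epsilon>) * caro_wei n E)} = 0"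
      if "average_degree n E = d" for E
      using average_degree_small[of n E \<epsilon>] n1 \<epsilon> that True by (simp add: indicator_def)
    then show ?thesis
      unfolding estimates_caro_wei_def using A by (intro exI[of _ A]) (auto intro!: exI[of _ 0])
  next
    case False
    then have d: "\<epsilon> < d" by simp
    have n: "n \<ge> 2" using two_le_vertices[OF E0(1)] E0 d \<epsilon> by simp
    define L where "L = log 2 (real n)"
    define q where "q = d\<^sup>2 / \<epsilon>\<^sup>2"
    have L: "L \<ge> 1" using n by (simp add: L_def)
    have q: "q \<ge> 1" using d \<epsilon> by (simp add: q_def power_mono)
    have ln_le: "ln (real n) \<le> L" "ln (real n) > 0"
    proof -
      have "ln (2::real) \<le> 1" using ln_le_minus_one[of 2] by simp
      moreover show "ln (real n) > 0" using n by simp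
      ultimately show "ln (real n) \<le> L" by (simp add: L_def log_def field_simps)
    qed
    \<comment> \<open>A state has three entries in \<open>{0..n}\<close>, and
      \<open>(n + 1) ^ 3 \<le> n ^ 6 = 2 powr (6 * L)\<close> for \<open>n \<ge> 2\<close>.\<close>
    define l where "l = nat \<lceil>6 * L\<rceil>"
    \<comment> \<open>The Hoeffding exponent \<open>2 * k * (\<epsilon> / (2 * d))\<^sup>2\<close>
      equals \<open>k / (2 * q)\<close>; this choice makes it at least
      \<open>3 * ln n\<close>.\<close>
    define k where "k = nat \<lceil>6 * q * ln (real n)\<rceil>"
    have l_ge: "6 * L \<le> real l" unfolding l_def by (rule real_nat_ceiling_ge)
    \<comment> \<open>Rounding up costs at most one further \<open>L\<close>, and for
      \<open>k\<close> one further \<open>q * L\<close>, as both are at least 1. This leads to the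
      constant \<open>49 = 7 * 7\<close>.\<close>
    have l_le: "real l \<le> 7 * L" using L by (simp add: l_def) linarith
    have k_ge: "6 * q * ln (real n) \<le> real k" unfolding k_def by (rule real_nat_ceiling_ge)
    have qL: "1 \<le> q * L" using mult_mono[of 1 q 1 L] q L by simp
    have k_le: "real k \<le> 7 * (q * L)"
    proof -
      have "real k \<le> 6 * q * ln (real n) + 1"
        using q ln_le by (simp add: k_def)
      also have "6 * q * ln (real n) \<le> 6 * q * L" using q ln_le by (intro mult_left_mono) auto
      finally show ?thesis using qL by simp
    qed
    have "0 < 6 * q * ln (real n)" using q ln_le by simp
    then have "real k > 0" using k_ge by linarith
    then have k: "k > 0" by simp
    have "(n + 1) ^ 3 \<le> (n\<^sup>2) ^ 3"
    proof (rule power_mono)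
      have "2 * n \<le> n * n" using n by simp
      then show "n + 1 \<le> n\<^sup>2" using n unfolding power2_eq_square by linarith
    qed simp
    then have "real ((n + 1) ^ 3) \<le> real n ^ 6"
      by (metis of_nat_mono of_nat_power power_mult num_double numeral_times_numeral semiring_norm(14))
    also have "\<dots> = 2 powr (6 * L)"
      using n by (simp add: L_def powr_powr[symmetric] mult.commute[of 6] powr_realpow)
    also have "\<dots> \<le> 2 powr (real l)" using l_ge by simp
    also have "\<dots> = real (2 ^ l)" by (simp add: powr_realpow)
    finally have l: "(n + 1) ^ 3 \<le> 2 ^ l" by (simp only: of_nat_le_iff)
    obtain A where A: "uses_bits A (l * k)"
      "\<And>E \<sigma>. simple_graph_on n E \<Longrightarrow> average_degree n E = d \<Longrightarrow> insertion_stream E \<sigma> \<Longrightarrow>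
        measure_pmf.prob (run A \<sigma>)
          {x. \<not> ((1 - \<epsilon>) * caro_wei n E \<le> x \<and> x \<le> (1 + \<epsilon>) * caro_wei n E)}
        \<le> 2 * exp (- 2 * real k * (\<epsilon> / (2 * d))\<^sup>2)"
    proof (cases "d \<ge> 1")
      case True
      show ?thesis by (rule dense_sampling_alg[OF n1 True \<epsilon>(1) l k]) (rule that)
    next
      case False
      \<comment> \<open>The witness \<open>E0\<close> shows that \<open>n * d\<close> is a natural
        number; every graph on \<open>n\<close> vertices with average degree \<open>d\<close> has
        this degree sum.\<close>
      have N: "real (\<Sum>v=1..n. vertex_degree E0 v) = real n * d"
        using sum_vertex_degree[OF n1, of E0] E0 by simp
      show ?thesis
        by (rule sparse_sampling_alg[OF n1 _ _ \<epsilon>(1) l k N]) (use d \<epsilon> False that in auto)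
    qed
    have "real (l * k) \<le> 7 * L * (7 * (q * L))"
      using l_le k_le L by (simp only: of_nat_mult) (intro mult_mono, auto)
    then have space: "real (l * k) \<le> 49 * (d\<^sup>2 * (1 / \<epsilon>\<^sup>2) * (log 2 (real n))\<^sup>2)"
      by (simp add: q_def L_def power2_eq_square algebra_simps)
    have "3 * ln (real n) = 2 * (6 * q * ln (real n)) * (\<epsilon> / (2 * d))\<^sup>2"
      using d \<epsilon> by (simp add: q_def field_simps power2_eq_square)
    also have "\<dots> \<le> 2 * real k * (\<epsilon> / (2 * d))\<^sup>2"
      using k_ge by (intro mult_right_mono) auto
    \<comment> \<open>The leading 2 is absorbed by one factor \<open>n\<close>, which turns
      \<open>n powr (- 3)\<close> into \<open>n powr (- 2)\<close>.\<close>
    finally have "2 * exp (- 2 * real k * (\<epsilon> / (2 * d))\<^sup>2) \<le> real n * exp (- 3 * ln (real n))"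
      using n by (intro mult_mono) auto
    also have "\<dots> = real n powr 1 * real n powr (- 3)" using n by (simp add: powr_def)
    also have "\<dots> = real n powr (- 2)" using n powr_add[of "real n" 1 "- 3"] by simp
    finally have error: "2 * exp (- 2 * real k * (\<epsilon> / (2 * d))\<^sup>2) \<le> real n powr (- 2)" .
    show ?thesis
      unfolding estimates_caro_wei_def using A(1) space order_trans[OF A(2) error] by (intro exI[of _ A]) blast
  qed
next
  case False
  then show ?thesis unfolding estimates_caro_wei_def by blast
qed

theorem theorem8:
  "\<exists>c'::real. c' > 1 \<and> (\<exists>C::real. C > 0 \<and>
    (\<exists>CWEI2 :: real \<Rightarrow> nat \<Rightarrow> real \<Rightarrow> nat set stream_alg.
      \<forall>\<epsilon>::real. 0 < \<epsilon> \<and> \<epsilon> < 1 \<longrightarrow>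
      (\<forall>(n::nat) (E::nat set set). n \<ge> 1 \<and> simple_graph_on n E \<longrightarrow>
        (let d = average_degree n E; A = CWEI2 \<epsilon> n d; lam = caro_wei n E in
          (\<exists>s::nat. uses_bits A s \<and> real s \<le> C * (d\<^sup>2 * (1 / \<epsilon>\<^sup>2) * (log 2 (real n))\<^sup>2)) \<and>
          (\<forall>\<sigma>. insertion_stream E \<sigma> \<longrightarrow>
            measure_pmf.prob (run A \<sigma>)
              {x. \<not> ((1 - \<epsilon>) * lam \<le> x \<and> x \<le> (1 + \<epsilon>) * lam)}
            \<le> real n powr (- c'))))))"
proof -
  \<comment> \<open>The choice depends on \<open>\<epsilon>\<close>, \<open>n\<close> and
    \<open>d\<close> only, so the algorithm is fixed before the graph and the stream.\<close>
  define CWEI2 where "CWEI2 \<epsilon> n d = (SOME A. estimates_caro_wei \<epsilon> n d A)" for \<epsilon> n d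
  have CWEI2: "estimates_caro_wei \<epsilon> n d (CWEI2 \<epsilon> n d)" if "0 < \<epsilon>" "\<epsilon> < 1" for \<epsilon> n d
    unfolding CWEI2_def using estimates_caro_wei_exists[OF that] by (rule someI_ex)
  have bounds: "(\<exists>s. uses_bits (CWEI2 \<epsilon> n (average_degree n E)) s \<and>
      real s \<le> 49 * ((average_degree n E)\<^sup>2 * (1 / \<epsilon>\<^sup>2) * (log 2 (real n))\<^sup>2)) \<and>
    (\<forall>\<sigma>. insertion_stream E \<sigma> \<longrightarrow>
      measure_pmf.prob (run (CWEI2 \<epsilon> n (average_degree n E)) \<sigma>)
        {x. \<not> ((1 - \<epsilon>) * caro_wei n E \<le> x \<and> x \<le> (1 + \<epsilon>) * caro_wei n E)} \<le> real n powr (- 2))"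
    if "0 < \<epsilon> \<and> \<epsilon> < 1" "n \<ge> 1 \<and> simple_graph_on n E" for \<epsilon> :: real and n E
    using CWEI2[of \<epsilon> n "average_degree n E"] that unfolding estimates_caro_wei_def by blast
  show ?thesis
    unfolding Let_def
  proof (rule exI[of _ 2], rule conjI[OF _ exI[of _ 49]], simp, rule conjI[OF _ exI[of _ CWEI2]], simp,
      intro allI impI)
    fix \<epsilon> :: real and n E
    assume "0 < \<epsilon> \<and> \<epsilon> < 1" "n \<ge> 1 \<and> simple_graph_on n E"
    then show "(\<exists>s. uses_bits (CWEI2 \<epsilon> n (average_degree n E)) s \<and>
        real s \<le> 49 * ((average_degree n E)\<^sup>2 * (1 / \<epsilon>\<^sup>2) * (log 2 (real n))\<^sup>2)) \<and>
      (\<forall>\<sigma>. insertion_stream E \<sigma> \<longrightarrow>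
        measure_pmf.prob (run (CWEI2 \<epsilon> n (average_degree n E)) \<sigma>)
          {x. \<not> ((1 - \<epsilon>) * caro_wei n E \<le> x \<and> x \<le> (1 + \<epsilon>) * caro_wei n E)} \<le> real n powr (- 2))"
      by (rule bounds)
  qed
qed

end
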